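(* Let $\{\hat p_{d,t},\check p_{d,t}\}_{t\in\mathcal T}$, together with the associated per-vehicle variables $\{\hat p^c_{v,t},\hat e_{v,t},\check p^c_{v,t},\check e_{v,t}\}_{v\in\mathcal V,t\in\mathcal T}$, be a solution of the offline problem P1 described in the context. Then any aggregate EV charging power trajectory $(p_{d,1},\dots,p_{d,T})\in[\check p_{d,1},\hat p_{d,1}]\times\cdots\times[\check p_{d,T},\hat p_{d,T}]$ is achievable. That is, there exist individual charging powers $p^c_{v,t}$ and energy levels $e_{v,t}$ ($v\in\mathcal V$, $t\in\mathcal T$) such that $$p_{d,t}=\sum_{v\in\mathcal V}p^c_{v,t}\quad\forall t\in\mathcal T,$$ $$0\le p^c_{v,t}\le p_v^{max}\quad\forall v,\ \forall t\in[t_v^a,t_v^d],\qquad p^c_{v,t}=0\quad\forall v,\ \forall t\notin[t_v^a,t_v^d],$$ $$e_{v,t+1}=e_{v,t}+\eta_c\,p^c_{v,t}\,\Delta t\quad\forall v,\ \forall t\ne T,$$ $$e_{v,t_v^a}=e_v^a,\qquad e_{v,t_v^d}\ge e_v^d\quad\forall v,\qquad e_v^{min}\le e_{v,t}\le e_v^{max}\quad\forall v,\ \forall t.$$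
   Context: Time slots are $\mathcal T=\{1,\dots,T\}$, each of length $\Delta t>0$, and $\mathcal V$ is a finite set of electric vehicles (EVs). Each EV $v$ has an arrival slot $t_v^a$ and a departure slot $t_v^d$ in $\mathcal T$ with $t_v^a<t_v^d$, an initial energy $e_v^a$ at arrival, a desired energy $e_v^d$ at departure, a maximum charging power $p_v^{max}\ge 0$, and battery energy limits $e_v^{min}\le e_v^{max}$. The charging efficiency is $\eta_c>0$, common to all EVs. The electricity prices are $\pi_t$. Problem P1: choose $\hat p_{d,t},\check p_{d,t}$ (with per-vehicle variables $\hat p^c_{v,t},\hat e_{v,t},\check p^c_{v,t},\check e_{v,t}$) to maximize the time-average expected flexibility value $\frac1T\sum_{t=1}^T\mathbb E[F_t]$, where $F_t=\pi_t(\hat p_{d,t}-\check p_{d,t})$, subject to the following constraints. (i) Upper trajectory: $\hat p_{d,t}=\sum_{v\in\mathcal V}\hat p^c_{v,t}$ for all $t$; $0\le\hat p^c_{v,t}\le p_v^{max}$ for all $v$ and $t\in[t_v^a,t_v^d]$; $\hat e_{v,t+1}=\hat e_{v,t}+\eta_c\hat p^c_{v,t}\Delta t$ for all $v$ and $t\neq T$; $\hat e_{v,t_v^a}=e_v^a$ and $\hat e_{v,t_v^d}\ge e_v^d$ for all $v$; $e_v^{min}\le\hat e_{v,t}\le e_v^{max}$ for all $v,t$. (ii) Lower trajectory: the same constraints with every hat replaced by a check, i.e. $\check p_{d,t}=\sum_{v\in\mathcal V}\check p^c_{v,t}$ for all $t$; $0\le\check p^c_{v,t}\le p_v^{max}$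 for all $v$ and $t\in[t_v^a,t_v^d]$; $\check e_{v,t+1}=\check e_{v,t}+\eta_c\check p^c_{v,t}\Delta t$ for all $v$ and $t\neq T$; $\check e_{v,t_v^a}=e_v^a$ and $\check e_{v,t_v^d}\ge e_v^d$ for all $v$; $e_v^{min}\le\check e_{v,t}\le e_v^{max}$ for all $v,t$. (iii) Joint constraints: $\check p_{d,t}\le\hat p_{d,t}$ for all $t$; $\hat p^c_{v,t}=\check p^c_{v,t}=0$ for all $v$ and all $t\notin[t_v^a,t_v^d]$. *)

theory Defs
  imports "HOL-Probability.Probability"
begin

record 'v ev_system =
  horizon :: nat                  \<comment> \<open>\<open>T\<close>; the slots are \<open>1, \<dots>, T\<close>\<close>
  slot_len :: real                \<comment> \<open>\<open>\<Delta>t\<close>\<close>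
  vehicles :: "'v set"
  arrival :: "'v \<Rightarrow> nat"
  departure :: "'v \<Rightarrow> nat"
  e_arr :: "'v \<Rightarrow> real"
  e_des :: "'v \<Rightarrow> real"           \<comment> \<open>desired energy at departure\<close>
  p_max :: "'v \<Rightarrow> real"
  e_min :: "'v \<Rightarrow> real"
  e_max :: "'v \<Rightarrow> real"
  eta_c :: real                   \<comment> \<open>charging efficiency\<close>

abbreviation slots :: "('v, 'z) ev_system_scheme \<Rightarrow> nat set" where
  "slots S \<equiv> {1..horizon S}"

definition wf_ev_system :: "'v ev_system \<Rightarrow> bool" where
  "wf_ev_system S \<longleftrightarrow>
     horizon S \<ge> 1 \<and> slot_len S > 0 \<and> finite (vehicles S) \<and> eta_c S > 0 \<and>
     (\<forall>v\<in>vehicles S.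
        arrival S v \<in> slots S \<and> departure S v \<in> slots S \<and> arrival S v < departure S v \<and>
        p_max S v \<ge> 0 \<and> e_min S v \<le> e_max S v)"

definition trajectory_constraints ::
  "'v ev_system \<Rightarrow> (nat \<Rightarrow> real) \<Rightarrow> ('v \<Rightarrow> nat \<Rightarrow> real) \<Rightarrow> ('v \<Rightarrow> nat \<Rightarrow> real) \<Rightarrow> bool" where
  "trajectory_constraints S pd pc e \<longleftrightarrow>
     (\<forall>t\<in>slots S. pd t = (\<Sum>v\<in>vehicles S. pc v t)) \<and>
     (\<forall>v\<in>vehicles S. \<forall>t\<in>{arrival S v..departure S v}. 0 \<le> pc v t \<and> pc v t \<le> p_max S v) \<and>
     (\<forall>v\<in>vehicles S. \<forall>t\<in>slots S. t \<noteq> horizon S \<longrightarrow>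
        e v (t + 1) = e v t + eta_c S * pc v t * slot_len S) \<and>
     (\<forall>v\<in>vehicles S. e v (arrival S v) = e_arr S v \<and> e v (departure S v) \<ge> e_des S v) \<and>
     (\<forall>v\<in>vehicles S. \<forall>t\<in>slots S. e_min S v \<le> e v t \<and> e v t \<le> e_max S v)"

definition idle_when_absent :: "'v ev_system \<Rightarrow> ('v \<Rightarrow> nat \<Rightarrow> real) \<Rightarrow> bool" where
  "idle_when_absent S pc \<longleftrightarrow>
     (\<forall>v\<in>vehicles S. \<forall>t\<in>slots S. t \<notin> {arrival S v..departure S v} \<longrightarrow> pc v t = 0)"

text \<open>Decision variables of the offline problem: \<open>up\<close> stands for the hat (upper trajectory),
  \<open>lo\<close> for the check (lower trajectory).\<close>

record 'v decision =
  pd_up :: "nat \<Rightarrow> real"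
  pd_lo :: "nat \<Rightarrow> real"
  pc_up :: "'v \<Rightarrow> nat \<Rightarrow> real"
  e_up :: "'v \<Rightarrow> nat \<Rightarrow> real"
  pc_lo :: "'v \<Rightarrow> nat \<Rightarrow> real"
  e_lo :: "'v \<Rightarrow> nat \<Rightarrow> real"

definition P1_feasible :: "'v ev_system \<Rightarrow> 'v decision \<Rightarrow> bool" where
  "P1_feasible S x \<longleftrightarrow>
     trajectory_constraints S (pd_up x) (pc_up x) (e_up x) \<and>
     trajectory_constraints S (pd_lo x) (pc_lo x) (e_lo x) \<and>
     (\<forall>t\<in>slots S. pd_lo x t \<le> pd_up x t) \<and>
     idle_when_absent S (pc_up x) \<and> idle_when_absent S (pc_lo x)"

text \<open>The prices are random variables on a probability space \<open>M\<close>; the decision variables are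
  real numbers, not functions of the outcome. Deterministic prices are constant functions.\<close>

definition flexibility_value :: "(nat \<Rightarrow> 'w \<Rightarrow> real) \<Rightarrow> 'v decision \<Rightarrow> nat \<Rightarrow> 'w \<Rightarrow> real" where
  "flexibility_value price x t \<omega> = price t \<omega> * (pd_up x t - pd_lo x t)"

definition P1_objective ::
  "'v ev_system \<Rightarrow> 'w measure \<Rightarrow> (nat \<Rightarrow> 'w \<Rightarrow> real) \<Rightarrow> 'v decision \<Rightarrow> real" where
  "P1_objective S M price x =
     1 / real (horizon S) * (\<Sum>t\<in>slots S. prob_space.expectation M (flexibility_value price x t))"

definition P1_solution ::
  "'v ev_system \<Rightarrow> 'w measure \<Rightarrow> (nat \<Rightarrow> 'w \<Rightarrow> real) \<Rightarrow> 'v decision \<Rightarrow> bool" where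
  "P1_solution S M price x \<longleftrightarrow>
     P1_feasible S x \<and>
     (\<forall>y. P1_feasible S y \<longrightarrow> P1_objective S M price y \<le> P1_objective S M price x)"

definition achievable :: "'v ev_system \<Rightarrow> (nat \<Rightarrow> real) \<Rightarrow> bool" where
  "achievable S pd \<longleftrightarrow>
     (\<exists>pc e. trajectory_constraints S pd pc e \<and> idle_when_absent S pc)"

end

theory Submission
  imports Defs
begin

text \<open>Optimality plays no role. Since charging powers are nonnegative, energies increase in time,
  so the constraints on one vehicle are box constraints together with a lower bound on the total
  charge over a set of slots and an upper bound over a larger set. Such a polytope satisfies an
  exchange property: where a point \<open>x\<close> lies below another point \<open>y\<close>, it can be raised, possibly
  lowering a coordinate in which it exceeds \<open>y\<close>, so that it stays in the polytope and comes
  closer to \<open>y\<close>. Keep the upper trajectory \<open>y\<close> fixed and, among all feasible power profiles whose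
  aggregate is at most the target, take one closest to \<open>y\<close>; it exists by compactness, the lower
  trajectory being one such profile. By the exchange property its aggregate equals the target.\<close>

section \<open>Boxes with two nested sum bounds, and their aggregates\<close>

definition chain_polytope ::
  "('i \<Rightarrow> real) \<Rightarrow> 'i set \<Rightarrow> real \<Rightarrow> 'i set \<Rightarrow> real \<Rightarrow> ('i \<Rightarrow> real) set" where
  "chain_polytope c A D B U =
     {p. (\<forall>i. 0 \<le> p i \<and> p i \<le> c i) \<and> D \<le> sum p A \<and> sum p B \<le> U}"

lemma compact_PiE_UNIV:
  fixes K :: "'a \<Rightarrow> 'b::topological_space set"
  assumes "\<And>i. compact (K i)"
  shows "compact (PiE UNIV K)"
  using assms compactin_PiE[of "\<lambda>_. euclidean" UNIV K]
  by (simp add: euclidean_product_topology)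

lemma continuous_on_sum_coordinates: "continuous_on X (\<lambda>p::'i \<Rightarrow> real. sum p A)"
  by (intro continuous_on_sum continuous_on_subset[OF continuous_on_product_coordinates]) auto

text \<open>Every coordinate is confined to an interval, so the box is compact by Tychonoff even
  over an infinite index type; each sum bound cuts out a closed set.\<close>

lemma compact_chain_polytope: "compact (chain_polytope c A D B U)"
proof -
  have "chain_polytope c A D B U =
      PiE UNIV (\<lambda>i. {0..c i}) \<inter> {p. D \<le> sum p A} \<inter> {p. sum p B \<le> U}"
    by (auto simp: chain_polytope_def)
  moreover have "closed {p::'a \<Rightarrow> real. D \<le> sum p A}" "closed {p::'a \<Rightarrow> real. sum p B \<le> U}"
    by (intro closed_Collect_le continuous_on_sum_coordinates continuous_on_const)+
  ultimately show ?thesis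
    by (simp add: compact_Int_closed compact_PiE_UNIV)
qed

lemma sum_fun_upd:
  fixes p :: "'i \<Rightarrow> real"
  assumes "finite A"
  shows "sum (p(t := a)) A = sum p A + (if t \<in> A then a - p t else 0)"
proof -
  have "sum (p(t := a)) A = (\<Sum>i\<in>A. p i + (if i = t then a - p t else 0))"
    by (intro sum.cong) auto
  then show ?thesis
    using assms by (simp add: sum.distrib sum.delta)
qed

lemma sum_abs_diff_less:
  fixes x x' y :: "'i \<Rightarrow> real"
  assumes "finite I" "t \<in> I" "\<bar>x' t - y t\<bar> < \<bar>x t - y t\<bar>"
    and "\<And>i. \<bar>x' i - y i\<bar> \<le> \<bar>x i - y i\<bar>"
  shows "(\<Sum>i\<in>I. \<bar>x' i - y i\<bar>) < (\<Sum>i\<in>I. \<bar>x i - y i\<bar>)"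
  using assms by (intro sum_strict_mono_ex1) auto

text \<open>If the bound on \<open>B\<close> leaves room, \<open>t\<close> alone is raised;
  otherwise the same amount is moved from some \<open>s\<close> to \<open>t\<close>, which preserves
  the sum over \<open>B\<close>. Changed coordinates stay between \<open>x\<close> and
  \<open>y\<close>, hence inside the box and closer to \<open>y\<close>. As only \<open>t\<close>
  can rise, and by at most \<delta>, bounds on aggregates survive the move.\<close>

lemma chain_polytope_exchange:
  fixes x y :: "'i \<Rightarrow> real"
  assumes x: "x \<in> chain_polytope c A D B U" and y: "y \<in> chain_polytope c A D B U"
    and fin: "finite I" "finite B" and AB: "A \<subseteq> B"
    and t: "t \<in> I" "x t < y t" and \<delta>: "\<delta> > 0"
  obtains x' where "x' \<in> chain_polytope c A D B U" "x' t \<le> x t + \<delta>"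
    "\<And>i. i \<noteq> t \<Longrightarrow> x' i \<le> x i"
    "(\<Sum>i\<in>I. \<bar>x' i - y i\<bar>) < (\<Sum>i\<in>I. \<bar>x i - y i\<bar>)"
proof -
  have finA: "finite A"
    using AB fin(2) finite_subset by blast
  have bx: "0 \<le> x i" "x i \<le> c i" and by': "0 \<le> y i" "y i \<le> c i" for i
    using x y by (auto simp: chain_polytope_def)
  have Dx: "D \<le> sum x A" and Ux: "sum x B \<le> U" and Dy: "D \<le> sum y A" and Uy: "sum y B \<le> U"
    using x y by (auto simp: chain_polytope_def)
  show thesis
  proof (cases "t \<in> B \<and> sum x B = U")
    case False
    \<comment> \<open>The 1 is a dummy: for \<open>t \<notin> B\<close> neither sum changes.\<close>
    define \<epsilon> where "\<epsilon> = min (min \<delta> (y t - x t)) (if t \<in> B then U - sum x B else 1)"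
    have \<epsilon>: "0 < \<epsilon>" "\<epsilon> \<le> \<delta>" "\<epsilon> \<le> y t - x t" "t \<in> B \<Longrightarrow> \<epsilon> \<le> U - sum x B"
      using False Ux t \<delta> by (auto simp: \<epsilon>_def)
    let ?x = "x(t := x t + \<epsilon>)"
    have "?x i \<le> c i \<and> 0 \<le> ?x i" for i
      using bx[of i] by'[of i] \<epsilon> by auto
    then have "?x \<in> chain_polytope c A D B U"
      using Dx Ux \<epsilon> unfolding chain_polytope_def
      by (auto simp: sum_fun_upd fin finA simp del: fun_upd_apply)
    then show thesis
      using \<epsilon> t by (intro that[of ?x] sum_abs_diff_less[OF fin(1) t(1)]) auto
  next
    case True
    \<comment> \<open>The upper bound is tight, so another coordinate must drop. The lower bound only restricts
      the case \<open>t \<notin> A\<close>, \<open>s \<in> A\<close>, which is chosen only when all of \<open>B - A\<close> is below \<open>y\<close>.\<close>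
    have "\<exists>s\<in>B. y s < x s \<and> (s \<in> A \<longrightarrow> t \<notin> A \<longrightarrow> D < sum x A)"
    proof (cases "t \<notin> A \<and> (\<forall>s\<in>B - A. x s \<le> y s)")
      case True
      \<comment> \<open>On \<open>B - A\<close>, \<open>x\<close> is below \<open>y\<close> in
        total, yet its sum over \<open>B\<close> is the largest allowed. So \<open>x\<close> exceeds
        \<open>y\<close> in total on \<open>A\<close>, which yields both \<open>s\<close> and the
        slack above \<open>D\<close>.\<close>
      have "sum x (B - A) < sum y (B - A)"
        using True \<open>t \<in> B \<and> _\<close> t fin by (intro sum_strict_mono_ex1) auto
      moreover have "sum x B = sum x (B - A) + sum x A" "sum y B = sum y (B - A) + sum y A"
        using AB fin by (auto intro: sum.subset_diff)
      ultimately have less: "sum y A < sum x A"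
        using Uy \<open>t \<in> B \<and> _\<close> by linarith
      then obtain s where "s \<in> A" "y s < x s"
        by (meson not_less sum_mono)
      then show ?thesis
        using less Dy AB by force
    next
      case False
      show ?thesis
      \<comment> \<open>For \<open>t \<in> A\<close> any \<open>s \<in> B\<close> above
        \<open>y\<close> will do, and without one \<open>y\<close> would violate the tight bound.
        For \<open>t \<notin> A\<close> the negated case assumption supplies
        \<open>s \<in> B - A\<close>.\<close>
      proof (cases "t \<in> A")
        case True
        have "\<exists>s\<in>B. y s < x s"
        proof (rule ccontr)
          assume "\<not> ?thesis"
          then have "sum x B < sum y B"
            using \<open>t \<in> B \<and> _\<close> t fin by (intro sum_strict_mono_ex1) auto
          then show False
            using Uy \<open>t \<in> B \<and> _\<close> by linarith
        qed
        then show ?thesis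
          using True by blast
      qed (use False in force)
    qed
    then obtain s where s: "s \<in> B" "y s < x s" "s \<in> A \<Longrightarrow> t \<notin> A \<Longrightarrow> D < sum x A"
      by blast
    \<comment> \<open>The sum over \<open>A\<close> drops only if \<open>s \<in> A\<close> and
      \<open>t \<notin> A\<close>; otherwise the 1 is a dummy.\<close>
    define \<epsilon> where "\<epsilon> = min (min \<delta> (y t - x t))
      (min (x s - y s) (if s \<in> A \<and> t \<notin> A then sum x A - D else 1))"
    have \<epsilon>: "0 < \<epsilon>" "\<epsilon> \<le> \<delta>" "\<epsilon> \<le> y t - x t" "\<epsilon> \<le> x s - y s"
      "s \<in> A \<Longrightarrow> t \<notin> A \<Longrightarrow> \<epsilon> \<le> sum x A - D"
      using s t \<delta> by (auto simp: \<epsilon>_def)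
    have "s \<noteq> t"
      using s t by auto
    let ?x = "x(t := x t + \<epsilon>, s := x s - \<epsilon>)"
    have "?x i \<le> c i \<and> 0 \<le> ?x i" for i
      using bx[of i] by'[of i] \<epsilon> by auto
    moreover have "sum ?x A = sum x A + (if t \<in> A then \<epsilon> else 0) - (if s \<in> A then \<epsilon> else 0)"
      using \<open>s \<noteq> t\<close> by (simp add: sum_fun_upd finA fun_upd_other del: fun_upd_apply)
    moreover have "sum ?x B = sum x B"
      using \<open>s \<noteq> t\<close> s True by (simp add: sum_fun_upd fin fun_upd_other del: fun_upd_apply)
    ultimately have "?x \<in> chain_polytope c A D B U"
      using Dx Ux \<epsilon> unfolding chain_polytope_def by (auto simp del: fun_upd_apply)
    then show thesis
      using \<epsilon> t \<open>s \<noteq> t\<close> by (intro that[of ?x] sum_abs_diff_less[OF fin(1) t(1)]) auto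
  qed
qed

text \<open>Convexity would give only the segment between the two aggregates; the exchange property
  gives the whole box.\<close>

lemma chain_polytope_sum_between:
  fixes x y c :: "'v \<Rightarrow> 'i \<Rightarrow> real" and A B :: "'v \<Rightarrow> 'i set" and D U :: "'v \<Rightarrow> real"
  defines "P \<equiv> \<lambda>v. chain_polytope (c v) (A v) (D v) (B v) (U v)"
  assumes fin: "finite V" "finite I" "\<And>v. v \<in> V \<Longrightarrow> finite (B v)"
    and AB: "\<And>v. v \<in> V \<Longrightarrow> A v \<subseteq> B v"
    and x: "\<And>v. v \<in> V \<Longrightarrow> x v \<in> P v" and y: "\<And>v. v \<in> V \<Longrightarrow> y v \<in> P v"
    and lo: "\<And>t. t \<in> I \<Longrightarrow> (\<Sum>v\<in>V. x v t) \<le> p t"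
    and up: "\<And>t. t \<in> I \<Longrightarrow> p t \<le> (\<Sum>v\<in>V. y v t)"
  obtains z where "\<And>v. v \<in> V \<Longrightarrow> z v \<in> P v" "\<And>t. t \<in> I \<Longrightarrow> (\<Sum>v\<in>V. z v t) = p t"
proof -
  \<comment> \<open>Outside \<open>V\<close> the profile is pinned to that of \<open>x\<close>, so
    that the product over the whole type is compact and contains \<open>x\<close>.\<close>
  define K where "K = PiE UNIV (\<lambda>v. if v \<in> V then P v else {x v})"
  define Q where "Q = K \<inter> (\<Inter>t\<in>I. {z. (\<Sum>v\<in>V. z v t) \<le> p t})"
  have cont: "continuous_on X (\<lambda>z::'v \<Rightarrow> 'i \<Rightarrow> real. z v t)" for X v t
    by (intro continuous_on_product_then_coordinatewise[of _ "\<lambda>z. z v"]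
        continuous_on_subset[OF continuous_on_product_coordinates]) auto
  have "compact K"
    unfolding K_def P_def by (intro compact_PiE_UNIV) (auto simp: compact_chain_polytope)
  moreover have "closed (\<Inter>t\<in>I. {z::'v \<Rightarrow> 'i \<Rightarrow> real. (\<Sum>v\<in>V. z v t) \<le> p t})"
    by (intro closed_INT ballI closed_Collect_le continuous_on_sum cont continuous_on_const)
  ultimately have "compact Q"
    unfolding Q_def by (rule compact_Int_closed)
  moreover have "x \<in> Q"
    using x lo by (auto simp: Q_def K_def)
  moreover have "continuous_on Q (\<lambda>z. \<Sum>v\<in>V. \<Sum>t\<in>I. \<bar>z v t - y v t\<bar>)"
    by (intro continuous_on_sum continuous_on_rabs continuous_on_diff cont continuous_on_const)
  ultimately obtain z where "z \<in> Q" and min: "\<forall>z'\<in>Q.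
      (\<Sum>v\<in>V. \<Sum>t\<in>I. \<bar>z v t - y v t\<bar>) \<le> (\<Sum>v\<in>V. \<Sum>t\<in>I. \<bar>z' v t - y v t\<bar>)"
    using continuous_attains_inf[of Q "\<lambda>z. \<Sum>v\<in>V. \<Sum>t\<in>I. \<bar>z v t - y v t\<bar>"] by auto
  have zP: "z v \<in> P v" if "v \<in> V" for v
    using \<open>z \<in> Q\<close> that by (auto simp: Q_def K_def PiE_iff split: if_splits)
  have zx: "z v = x v" if "v \<notin> V" for v
    using \<open>z \<in> Q\<close> that by (auto simp: Q_def K_def PiE_iff split: if_splits)
  have zle: "(\<Sum>v\<in>V. z v t) \<le> p t" if "t \<in> I" for t
    using \<open>z \<in> Q\<close> that by (auto simp: Q_def)
  have "(\<Sum>v\<in>V. z v t) = p t" if "t \<in> I" for t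
  proof (rule ccontr)
    assume "\<not> ?thesis"
    then have less: "(\<Sum>v\<in>V. z v t) < p t"
      using zle[OF that] by simp
    with up[OF that] have "(\<Sum>v\<in>V. z v t) < (\<Sum>v\<in>V. y v t)"
      by linarith
    then obtain v where v: "v \<in> V" "z v t < y v t"
      by (meson not_less sum_mono)
    \<comment> \<open>The shortfall at \<open>t\<close> is the step limit \<delta>: one vehicle
      rising by at most this much cannot push the aggregate above \<open>p t\<close>.\<close>
    have "0 < p t - (\<Sum>v\<in>V. z v t)"
      using less by simp
    from chain_polytope_exchange[OF zP[OF v(1), unfolded P_def] y[OF v(1), unfolded P_def]
        fin(2) fin(3)[OF v(1)] AB[OF v(1)] that v(2) this]
    obtain x' where x': "x' \<in> P v" "x' t \<le> z v t + (p t - (\<Sum>v\<in>V. z v t))"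
      "\<And>i. i \<noteq> t \<Longrightarrow> x' i \<le> z v i"
      "(\<Sum>i\<in>I. \<bar>x' i - y v i\<bar>) < (\<Sum>i\<in>I. \<bar>z v i - y v i\<bar>)"
      unfolding P_def by blast
    let ?z = "z(v := x')"
    have "(\<Sum>u\<in>V. ?z u i) \<le> p i" if "i \<in> I" for i
    proof -
      \<comment> \<open>At a fixed slot, replacing the profile of \<open>v\<close> is a one-point
        update in the vehicle index, the form \<open>sum_fun_upd\<close> expects.\<close>
      have "(\<Sum>u\<in>V. ?z u i) = (\<Sum>u\<in>V. ((\<lambda>u. z u i)(v := x' i)) u)"
        by (intro sum.cong) auto
      then have "(\<Sum>u\<in>V. ?z u i) = (\<Sum>u\<in>V. z u i) + (x' i - z v i)"
        using v(1) by (simp only: sum_fun_upd[OF fin(1)] if_True)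
      then show ?thesis
        using x'(2,3) zle[OF that] by (cases "i = t") force+
    qed
    then have "?z \<in> Q"
      using x'(1) v(1) zP zx by (auto simp: Q_def K_def)
    moreover have "(\<Sum>u\<in>V. \<Sum>i\<in>I. \<bar>?z u i - y u i\<bar>) < (\<Sum>u\<in>V. \<Sum>i\<in>I. \<bar>z u i - y u i\<bar>)"
      using x'(4) v(1) by (intro sum_strict_mono_ex1[OF fin(1)]) auto
    ultimately show False
      using min by fastforce
  qed
  with zP show thesis
    by (rule that)
qed

section \<open>Charging profiles of a single vehicle\<close>

text \<open>Power in slot \<open>t\<close> first shows in the energy at \<open>t + 1\<close>, hence
  the half-open ranges. Charging in the departure slot misses the demand but still counts towards
  \<open>e_max\<close>, so the upper range runs on to the horizon. As energy never decreases, its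
  maximum is at the horizon.\<close>

definition vehicle_polytope :: "'v ev_system \<Rightarrow> 'v \<Rightarrow> (nat \<Rightarrow> real) set" where
  "vehicle_polytope S v = chain_polytope
     (\<lambda>t. if t \<in> {arrival S v..departure S v} then p_max S v else 0)
     {arrival S v..<departure S v} ((e_des S v - e_arr S v) / (eta_c S * slot_len S))
     {arrival S v..<horizon S} ((e_max S v - e_arr S v) / (eta_c S * slot_len S))"

text \<open>The energy recursion telescopes from the arrival slot. The profile is cut to zero
  outside the slots, where the constraints say nothing about \<open>pc\<close>.\<close>

lemma trajectory_in_vehicle_polytope:
  assumes wf: "wf_ev_system S" and v: "v \<in> vehicles S"
    and tc: "trajectory_constraints S pd pc e" and idle: "idle_when_absent S pc"
  shows "(\<lambda>t. if t \<in> slots S then pc v t else 0) \<in> vehicle_polytope S v"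
proof -
  let ?p = "\<lambda>t. if t \<in> slots S then pc v t else 0"
  let ?a = "arrival S v" and ?d = "departure S v" and ?k = "eta_c S * slot_len S"
  have k: "?k > 0" and a: "?a \<in> slots S" "?d \<in> slots S" "?a < ?d"
    using wf v by (auto simp: wf_ev_system_def)
  have energy: "e v t = e_arr S v + ?k * sum ?p {?a..<t}" if "?a \<le> t" "t \<le> horizon S" for t
    using that
  proof (induction t rule: dec_induct)
    case base
    show ?case using tc v by (simp add: trajectory_constraints_def)
  next
    case (step t)
    have "t \<in> slots S" "t \<noteq> horizon S"
      using step a by auto
    moreover from this have "e v (t + 1) = e v t + eta_c S * pc v t * slot_len S"
      using tc v unfolding trajectory_constraints_def by blast
    ultimately show ?case
      using step by (simp add: algebra_simps)
  qed
  have "e_des S v \<le> e v ?d"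
    using tc v unfolding trajectory_constraints_def by blast
  then have "(e_des S v - e_arr S v) / ?k \<le> sum ?p {?a..<?d}"
    using energy[of ?d] a k by (simp add: pos_divide_le_eq mult.commute)
  moreover have "horizon S \<in> slots S"
    using a by auto
  then have "e v (horizon S) \<le> e_max S v"
    using tc v unfolding trajectory_constraints_def by blast
  then have "sum ?p {?a..<horizon S} \<le> (e_max S v - e_arr S v) / ?k"
    using energy[of "horizon S"] a k by (simp add: pos_le_divide_eq mult.commute)
  moreover have "0 \<le> ?p t \<and> ?p t \<le> (if t \<in> {?a..?d} then p_max S v else 0)" for t
  proof (cases "t \<in> {?a..?d}")
    case True
    then have "t \<in> slots S"
      using a by auto
    moreover have "0 \<le> pc v t \<and> pc v t \<le> p_max S v"
      using True tc v unfolding trajectory_constraints_def by blast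
    ultimately show ?thesis
      using True by simp
  next
    case False
    then have "?p t = 0"
      using idle v unfolding idle_when_absent_def by auto
    with False show ?thesis
      by (simp only: if_False order_refl simp_thms)
  qed
  ultimately show ?thesis
    unfolding vehicle_polytope_def chain_polytope_def by blast
qed

lemma achievable_if_vehicle_polytopes:
  assumes wf: "wf_ev_system S"
    and e_arr: "\<And>v. v \<in> vehicles S \<Longrightarrow> e_min S v \<le> e_arr S v"
    and p: "\<And>v. v \<in> vehicles S \<Longrightarrow> p v \<in> vehicle_polytope S v"
    and pd: "\<And>t. t \<in> slots S \<Longrightarrow> (\<Sum>v\<in>vehicles S. p v t) = pd t"
  shows "achievable S pd"
proof -
  let ?k = "eta_c S * slot_len S"
  \<comment> \<open>Before arrival the range is empty and the energy stays at \<open>e_arr\<close>,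
    in accordance with zero power there.\<close>
  define e where "e v t = e_arr S v + ?k * sum (p v) {arrival S v..<t}" for v t
  have k: "?k > 0"
    using wf by (auto simp: wf_ev_system_def)
  have box: "0 \<le> p v t" "p v t \<le> (if t \<in> {arrival S v..departure S v} then p_max S v else 0)"
    if "v \<in> vehicles S" for v t
    using p[OF that] unfolding vehicle_polytope_def chain_polytope_def by blast+
  have absent: "p v t = 0" if "v \<in> vehicles S" "t \<notin> {arrival S v..departure S v}" for v t
    using box[OF that(1), of t] that(2) by (auto split: if_splits)
  have des: "e_des S v \<le> e v (departure S v)" if "v \<in> vehicles S" for v
  proof -
    have "(e_des S v - e_arr S v) / ?k \<le> sum (p v) {arrival S v..<departure S v}"
      using p[OF that] unfolding vehicle_polytope_def chain_polytope_def by blast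
    then show ?thesis
      using k by (simp add: e_def pos_divide_le_eq algebra_simps)
  qed
  have step: "e v (t + 1) = e v t + eta_c S * p v t * slot_len S" if "v \<in> vehicles S" for v t
    using absent[OF that, of t]
    by (cases "arrival S v \<le> t") (auto simp: e_def algebra_simps)
  have lower: "e_min S v \<le> e v t" if "v \<in> vehicles S" for v t
  proof -
    have "0 \<le> ?k * sum (p v) {arrival S v..<t}"
      using box(1)[OF that] by (intro mult_nonneg_nonneg[OF less_imp_le[OF k]] sum_nonneg)
    then show ?thesis
      using e_arr[OF that] by (simp add: e_def)
  qed
  have upper: "e v t \<le> e_max S v" if "v \<in> vehicles S" "t \<in> slots S" for v t
  proof -
    have "sum (p v) {arrival S v..<t} \<le> sum (p v) {arrival S v..<horizon S}"
      using box(1)[OF that(1)] that(2) by (intro sum_mono2) auto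
    also have "\<dots> \<le> (e_max S v - e_arr S v) / ?k"
      using p[OF that(1)] unfolding vehicle_polytope_def chain_polytope_def by blast
    finally show ?thesis
      using k by (simp add: e_def pos_le_divide_eq algebra_simps)
  qed
  have "e v (arrival S v) = e_arr S v" for v
    by (simp add: e_def)
  moreover have "0 \<le> p v t \<and> p v t \<le> p_max S v"
    if "v \<in> vehicles S" "t \<in> {arrival S v..departure S v}" for v t
    using box[OF that(1), of t] that(2) by simp
  ultimately have "trajectory_constraints S pd p e"
    unfolding trajectory_constraints_def using pd des step lower upper by force
  moreover have "idle_when_absent S p"
    using absent unfolding idle_when_absent_def by blast
  ultimately show ?thesis
    unfolding achievable_def by blast
qed

theorem proposition1:
  fixes S :: "'v ev_system"
    and M :: "'w measure"
    and price :: "nat \<Rightarrow> 'w \<Rightarrow> real"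
    and x :: "'v decision"
    and pd :: "nat \<Rightarrow> real"
  assumes "wf_ev_system S"
    and "prob_space M"
    and "\<And>t. t \<in> slots S \<Longrightarrow> integrable M (price t)"
    and "P1_solution S M price x"
    and "\<And>t. t \<in> slots S \<Longrightarrow> pd t \<in> {pd_lo x t..pd_up x t}"
  shows "achievable S pd"
proof -
  have up: "trajectory_constraints S (pd_up x) (pc_up x) (e_up x)" "idle_when_absent S (pc_up x)"
    and lo: "trajectory_constraints S (pd_lo x) (pc_lo x) (e_lo x)" "idle_when_absent S (pc_lo x)"
    using assms(4) by (auto simp: P1_solution_def P1_feasible_def)
  let ?lo = "\<lambda>v t. if t \<in> slots S then pc_lo x v t else 0"
  let ?up = "\<lambda>v t. if t \<in> slots S then pc_up x v t else 0"
  have dep: "departure S v \<le> horizon S" if "v \<in> vehicles S" for v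
    using assms(1) that by (auto simp: wf_ev_system_def)
  have bounds: "(\<Sum>v\<in>vehicles S. ?lo v t) \<le> pd t" "pd t \<le> (\<Sum>v\<in>vehicles S. ?up v t)"
    if "t \<in> slots S" for t
    using assms(5)[OF that] up(1) lo(1) that by (auto simp: trajectory_constraints_def)
  have fin: "finite (vehicles S)"
    using assms(1) by (simp add: wf_ev_system_def)
  obtain z where z: "\<And>v. v \<in> vehicles S \<Longrightarrow> z v \<in> vehicle_polytope S v"
    "\<And>t. t \<in> slots S \<Longrightarrow> (\<Sum>v\<in>vehicles S. z v t) = pd t"
  \<comment> \<open>The larger range \<open>B\<close> is instantiated before \<open>A\<close>;
    folding turns the instantiated polytopes into \<open>vehicle_polytope\<close>.\<close>
  proof (rule chain_polytope_sum_between[of "vehicles S" "slots S"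
        "\<lambda>v. {arrival S v..<horizon S}" "\<lambda>v. {arrival S v..<departure S v}" ?lo
        "\<lambda>v t. if t \<in> {arrival S v..departure S v} then p_max S v else 0"
        "\<lambda>v. (e_des S v - e_arr S v) / (eta_c S * slot_len S)"
        "\<lambda>v. (e_max S v - e_arr S v) / (eta_c S * slot_len S)" ?up pd,
        folded vehicle_polytope_def])
    show "{arrival S v..<departure S v} \<subseteq> {arrival S v..<horizon S}" if "v \<in> vehicles S" for v
      using dep[OF that] by auto
    show "?lo v \<in> vehicle_polytope S v" if "v \<in> vehicles S" for v
      by (rule trajectory_in_vehicle_polytope[OF assms(1) that lo])
    show "?up v \<in> vehicle_polytope S v" if "v \<in> vehicles S" for v
      by (rule trajectory_in_vehicle_polytope[OF assms(1) that up])
  qed (use fin bounds in \<open>blast | simp\<close>)+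
  \<comment> \<open>This comes from the feasibility of the upper trajectory at the arrival slot, not
    from \<open>wf_ev_system\<close>.\<close>
  have "e_min S v \<le> e_arr S v" if "v \<in> vehicles S" for v
  proof -
    have "arrival S v \<in> slots S"
      using assms(1) that by (auto simp: wf_ev_system_def)
    then have "e_min S v \<le> e_up x v (arrival S v)" "e_up x v (arrival S v) = e_arr S v"
      using up(1) that unfolding trajectory_constraints_def by blast+
    then show ?thesis
      by simp
  qed
  then show ?thesis
    using z by (rule achievable_if_vehicle_polytopes[OF assms(1)])
qed

end
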